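(* Let $\sigma$ be the index-one saddle of the potential, let $-\lambda_\sigma<0$ be the unique negative eigenvalue of $\nabla^2U(\sigma)$ with unit eigenvector $e_\sigma$, and let $L,\gamma>0$. Set $q_1=\langle\theta-\sigma,e_\sigma\rangle$, $v_1=\langle p,e_\sigma\rangle$, $w_1=\langle r,e_\sigma\rangle$. The deterministic part of the third-order Langevin diffusion, i.e. $\dot\theta=p$, $\dot p=-L^{-1}\nabla U(\theta)+\gamma r$, $\dot r=-\gamma p-\gamma r$, linearized at $(\sigma,0,0)$ and projected onto the unstable direction, is $\dot X_1=\mathsf A_\sigma X_1$ with $X_1=(q_1,v_1,w_1)^\top$ and $$\mathsf A_\sigma=\begin{pmatrix}0&1&0\\ \lambda_\sigma/L&0&\gamma\\ 0&-\gamma&-\gamma\end{pmatrix},\qquad \chi_\sigma(\mu)=\det(\mu I_3-\mathsf A_\sigma)=\mu^3+\gamma\mu^2+\left(\gamma^2-\frac{\lambda_\sigma}{L}\right)\mu-\frac{\gamma\lambda_\sigma}{L}.$$ The polynomial $\chi_\sigma$ has a unique positive root (denoted $\mu_\sigma$).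
   Context: $U\in C^\infty(\mathbb R^d)$ and $\sigma\in\mathbb R^d$ is a critical point of $U$ whose Hessian $\nabla^2U(\sigma)$ has exactly one negative eigenvalue $-\lambda_\sigma<0$ and $d-1$ positive eigenvalues. The phase space is $\mathbb R^{3d}\ni(\theta,p,r)$; the third-order Langevin diffusion is $d\theta=p\,dt$, $dp=(-L^{-1}\nabla U(\theta)+\gamma r)dt$, $dr=(-\gamma p-\gamma r)dt+\sqrt{2\gamma\varepsilon/L}\,dB$. *)

theory Defs
  imports "HOL-Analysis.Analysis" "HOL-Computational_Algebra.Computational_Algebra"
begin

primrec Ck_fun :: "nat \<Rightarrow> (real^'n \<Rightarrow> real) \<Rightarrow> bool" where
  "Ck_fun 0 f \<longleftrightarrow> continuous_on UNIV f"
| "Ck_fun (Suc k) f \<longleftrightarrow>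
     f differentiable_on UNIV \<and> (\<forall>v. Ck_fun k (\<lambda>x. frechet_derivative f (at x) v))"

definition smooth_fun :: "(real^'n \<Rightarrow> real) \<Rightarrow> bool" where
  "smooth_fun f \<longleftrightarrow> (\<forall>k. Ck_fun k f)"

definition grad :: "(real^'n \<Rightarrow> real) \<Rightarrow> real^'n \<Rightarrow> real^'n" where
  "grad U x = (THE D. GDERIV U x :> D)"

definition hessian :: "(real^'n \<Rightarrow> real) \<Rightarrow> real^'n \<Rightarrow> real^'n^'n" where
  "hessian U x = jacobian (grad U) (at x)"

definition charpoly :: "real^'n^'n \<Rightarrow> real poly" where
  "charpoly A = det (mat [:0, 1:] - (\<chi> i j. [:A $ i $ j:]))"

(* The real eigenvalues, each repeated according to its algebraic multiplicity. *)
definition eigenvalues :: "real^'n^'n \<Rightarrow> real multiset" where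
  "eigenvalues A = proots (charpoly A)"

(* The first multiset equation says that -lam is the only negative eigenvalue and that it is
   simple; in particular it forces lam > 0. *)
definition index_one_saddle :: "(real^'n \<Rightarrow> real) \<Rightarrow> real^'n \<Rightarrow> real \<Rightarrow> bool" where
  "index_one_saddle U \<sigma> lam \<longleftrightarrow>
     grad U \<sigma> = 0 \<and>
     filter_mset (\<lambda>x. x < 0) (eigenvalues (hessian U \<sigma>)) = {# -lam #} \<and>
     size (filter_mset (\<lambda>x. x > 0) (eigenvalues (hessian U \<sigma>))) = CARD('n) - 1"

definition langevin3_drift ::
    "real \<Rightarrow> real \<Rightarrow> (real^'n \<Rightarrow> real) \<Rightarrow>
     (real^'n) \<times> (real^'n) \<times> (real^'n) \<Rightarrow> (real^'n) \<times> (real^'n) \<times> (real^'n)" where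
  "langevin3_drift L \<gamma> U = (\<lambda>(\<theta>, p, r).
     (p,
      - (1 / L) *\<^sub>R grad U \<theta> + \<gamma> *\<^sub>R r,
      - \<gamma> *\<^sub>R p - \<gamma> *\<^sub>R r))"

definition linearization :: "('a::real_normed_vector \<Rightarrow> 'a) \<Rightarrow> 'a \<Rightarrow> 'a \<Rightarrow> 'a" where
  "linearization F z0 = (\<lambda>z. frechet_derivative F (at z0) (z - z0))"

definition solves_autonomous ::
    "('a::real_normed_vector \<Rightarrow> 'a) \<Rightarrow> real set \<Rightarrow> (real \<Rightarrow> 'a) \<Rightarrow> bool" where
  "solves_autonomous F T z \<longleftrightarrow>
     (\<forall>t\<in>T. (z has_vector_derivative F (z t)) (at t within T))"

definition unstable_coords ::
    "real^'n \<Rightarrow> real^'n \<Rightarrow> (real^'n) \<times> (real^'n) \<times> (real^'n) \<Rightarrow> real^3" where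
  "unstable_coords \<sigma> e = (\<lambda>(\<theta>, p, r).
     vector [(\<theta> - \<sigma>) \<bullet> e, p \<bullet> e, r \<bullet> e])"

definition A_mat :: "real \<Rightarrow> real \<Rightarrow> real \<Rightarrow> real^3^3" where
  "A_mat L \<gamma> lam = vector
     [vector [0,       1,   0],
      vector [lam / L, 0,   \<gamma>],
      vector [0,      - \<gamma>, - \<gamma>]]"

definition chi_poly :: "real \<Rightarrow> real \<Rightarrow> real \<Rightarrow> real \<Rightarrow> real" where
  "chi_poly L \<gamma> lam \<mu> = det (\<mu> *\<^sub>R mat 1 - A_mat L \<gamma> lam)"

end

theory Submission
  imports Defs
begin

text \<open>
  Three facts carry the theorem.

  The linearised flow splits along \<open>e\<close> because the Hessian \<open>H\<close> at the saddle is symmetric: the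
  component of \<open>H q\<close> along \<open>e\<close> is \<open>q \<bullet> H e = - lam (q \<bullet> e)\<close>, so the coordinates \<open>q\<^sub>1, v\<^sub>1, w\<^sub>1\<close>
  obey a closed system. That \<open>e\<close> is an eigenvector of \<open>H\<close> would not be enough, since the projection
  needs \<open>e\<close> to be an eigenvector of the transpose. Symmetry comes from \<open>mixed_derivatives_commute\<close>:
  the second difference over a parallelogram is, by the mean value theorem applied twice, an
  intermediate value of either mixed derivative.

  Solutions are transported by semiconjugacies (\<open>solves_autonomous_semiconj\<close>). The projection onto
  the unstable coordinates sends solutions of the linearisation to solutions of the
  three-dimensional system. Conversely the embedding \<open>(x\<^sub>1, x\<^sub>2, x\<^sub>3) \<mapsto> (\<sigma> + x\<^sub>1 e, x\<^sub>2 e, x\<^sub>3 e)\<close>,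
  a section of the projection because \<open>e\<close> is a unit vector, lifts every solution of that system,
  because \<open>H e = - lam e\<close> makes its image invariant.

  Divided by \<open>\<mu>\<close>, the characteristic polynomial is
  \<open>\<mu>\<^sup>2 + \<gamma> \<mu> + (\<gamma>\<^sup>2 - lam / L) - (\<gamma> lam / L) / \<mu>\<close>, which is strictly increasing for \<open>\<mu> > 0\<close>, so there
  is at most one positive root; there is one because the polynomial is negative at \<open>0\<close> and positive
  for large \<open>\<mu>\<close>.
\<close>

section \<open>Symmetry of second derivatives\<close>

lemma has_real_derivative_along_line:
  fixes f :: "'a::real_normed_vector \<Rightarrow> real"
  assumes "(f has_derivative f') (at (a + s *\<^sub>R u))"
  shows "((\<lambda>s. f (a + s *\<^sub>R u)) has_real_derivative f' u) (at s)"
proof -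
  have "((\<lambda>s. a + s *\<^sub>R u) has_derivative (\<lambda>h. h *\<^sub>R u)) (at s)"
    by (auto intro!: derivative_eq_intros)
  from diff_chain_at[OF this assms]
  have "((\<lambda>s. f (a + s *\<^sub>R u)) has_derivative (\<lambda>h. f' (h *\<^sub>R u))) (at s)"
    by (simp add: o_def)
  moreover have "f' (h *\<^sub>R u) = f' u * h" for h
    using has_derivative_bounded_linear[OF assms]
    by (simp add: bounded_linear.linear linear_cmul)
  ultimately show ?thesis
    by (simp add: has_field_derivative_def)
qed

text \<open>
  The left-hand side is symmetric in \<open>u\<close> and \<open>v\<close>, the right-hand side singles out one order of
  differentiation; comparing the two orders is what makes mixed derivatives agree.
\<close>

lemma second_difference_mean_value:
  fixes f :: "'a::real_normed_vector \<Rightarrow> real"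
  assumes f': "\<And>x. (f has_derivative f' x) (at x)"
    and f'': "\<And>x. ((\<lambda>x. f' x u) has_derivative f'' x) (at x)"
    and "h > 0"
  obtains s t where "0 < s" "s < h" "0 < t" "t < h"
    "f (x + h *\<^sub>R u + h *\<^sub>R v) - f (x + h *\<^sub>R u) - f (x + h *\<^sub>R v) + f x
       = h\<^sup>2 * f'' (x + s *\<^sub>R u + t *\<^sub>R v) v"
proof -
  let ?\<phi> = "\<lambda>s. f ((x + h *\<^sub>R v) + s *\<^sub>R u) - f (x + s *\<^sub>R u)"
  have "(?\<phi> has_real_derivative f' ((x + h *\<^sub>R v) + s *\<^sub>R u) u - f' (x + s *\<^sub>R u) u) (at s)" for s
    by (intro DERIV_diff has_real_derivative_along_line f')
  from MVT2[OF \<open>h > 0\<close> this] obtain s where s: "0 < s" "s < h"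
    "?\<phi> h - ?\<phi> 0 = h * (f' ((x + h *\<^sub>R v) + s *\<^sub>R u) u - f' (x + s *\<^sub>R u) u)"
    by auto
  let ?\<psi> = "\<lambda>t. f' ((x + s *\<^sub>R u) + t *\<^sub>R v) u"
  have "(?\<psi> has_real_derivative f'' ((x + s *\<^sub>R u) + t *\<^sub>R v) v) (at t)" for t
    by (rule has_real_derivative_along_line[OF f''])
  from MVT2[OF \<open>h > 0\<close> this] obtain t where t: "0 < t" "t < h"
    "?\<psi> h - ?\<psi> 0 = h * f'' ((x + s *\<^sub>R u) + t *\<^sub>R v) v"
    by auto
  show thesis
    by (rule that[OF s(1,2) t(1,2)])
      (use s(3) t(3) in \<open>simp add: power2_eq_square algebra_simps\<close>)
qed

text \<open>
  At each scale \<open>h\<close> the two mixed derivatives share a value, taken at two possibly different points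
  of the parallelogram with corner \<open>x\<close> and sides \<open>h u\<close>, \<open>h v\<close>. As \<open>h\<close> tends to \<open>0\<close> both points converge
  to \<open>x\<close>, and continuity there turns the shared values into equality at \<open>x\<close>.
\<close>

theorem mixed_derivatives_commute:
  fixes f :: "'a::real_normed_vector \<Rightarrow> real"
  assumes f': "\<And>x. (f has_derivative f' x) (at x)"
    and fu: "\<And>x. ((\<lambda>x. f' x u) has_derivative fu x) (at x)"
    and fv: "\<And>x. ((\<lambda>x. f' x v) has_derivative fv x) (at x)"
    and cont: "isCont (\<lambda>x. fu x v) x" "isCont (\<lambda>x. fv x u) x"
  shows "fu x v = fv x u"
proof -
  have "\<exists>s t s' t'. 0 < s \<and> s < h \<and> 0 < t \<and> t < h \<and> 0 < s' \<and> s' < h \<and> 0 < t' \<and> t' < h \<and>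
      fu (x + s *\<^sub>R u + t *\<^sub>R v) v = fv (x + s' *\<^sub>R u + t' *\<^sub>R v) u" if "h > 0" for h :: real
  proof -
    let ?\<Delta> = "\<lambda>u v. f (x + h *\<^sub>R u + h *\<^sub>R v) - f (x + h *\<^sub>R u) - f (x + h *\<^sub>R v) + f x"
    obtain s t where st: "0 < s" "s < h" "0 < t" "t < h"
      "?\<Delta> u v = h\<^sup>2 * fu (x + s *\<^sub>R u + t *\<^sub>R v) v"
      using second_difference_mean_value[OF f' fu \<open>h > 0\<close>] by metis
    obtain t' s' where ts: "0 < t'" "t' < h" "0 < s'" "s' < h"
      "?\<Delta> v u = h\<^sup>2 * fv (x + t' *\<^sub>R v + s' *\<^sub>R u) u"
      using second_difference_mean_value[OF f' fv \<open>h > 0\<close>] by metis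
    have "h\<^sup>2 * fu (x + s *\<^sub>R u + t *\<^sub>R v) v = h\<^sup>2 * fv (x + s' *\<^sub>R u + t' *\<^sub>R v) u"
      using st(5) ts(5) by (simp add: algebra_simps)
    then show ?thesis
      using st(1-4) ts(1-4) \<open>h > 0\<close> by auto
  qed
  then obtain s t s' t' where
    bnd: "\<And>h::real. h > 0 \<Longrightarrow> 0 < s h \<and> s h < h \<and> 0 < t h \<and> t h < h
            \<and> 0 < s' h \<and> s' h < h \<and> 0 < t' h \<and> t' h < h"
    and eq: "\<And>h. h > 0 \<Longrightarrow>
            fu (x + s h *\<^sub>R u + t h *\<^sub>R v) v = fv (x + s' h *\<^sub>R u + t' h *\<^sub>R v) u"
    by metis
  have null: "(k \<longlongrightarrow> 0) (at_right 0)" if "\<And>h::real. h > 0 \<Longrightarrow> 0 < k h \<and> k h < h"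
    for k :: "real \<Rightarrow> real"
  proof (rule tendsto_sandwich)
    show "eventually (\<lambda>h. 0 \<le> k h) (at_right 0)" "eventually (\<lambda>h. k h \<le> h) (at_right 0)"
      using that by (auto simp: eventually_at_filter less_imp_le)
  qed (auto intro!: tendsto_eq_intros)
  have point: "((\<lambda>h. x + k h *\<^sub>R u + l h *\<^sub>R v) \<longlongrightarrow> x) (at_right 0)"
    if "(k \<longlongrightarrow> 0) (at_right 0)" "(l \<longlongrightarrow> 0) (at_right 0)" for k l :: "real \<Rightarrow> real"
    using that by (auto intro!: tendsto_eq_intros)
  have lim_u: "((\<lambda>h. fu (x + s h *\<^sub>R u + t h *\<^sub>R v) v) \<longlongrightarrow> fu x v) (at_right 0)"
    by (rule isCont_tendsto_compose[OF cont(1)]) (intro point null; use bnd in blast)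
  have lim_v: "((\<lambda>h. fv (x + s' h *\<^sub>R u + t' h *\<^sub>R v) u) \<longlongrightarrow> fv x u) (at_right 0)"
    by (rule isCont_tendsto_compose[OF cont(2)]) (intro point null; use bnd in blast)
  have "((\<lambda>h. fu (x + s h *\<^sub>R u + t h *\<^sub>R v) v) \<longlongrightarrow> fv x u) (at_right 0)"
    using lim_v
    by (rule Lim_transform_eventually) (auto simp: eventually_at_filter eq)
  with lim_u show ?thesis
    by (intro tendsto_unique[of "at_right (0::real)"]) auto
qed

section \<open>Gradient and Hessian\<close>

lemma has_derivative_grad:
  assumes "U differentiable at x"
  shows "(U has_derivative (\<lambda>v. grad U x \<bullet> v)) (at x)"
proof -
  have D: "(U has_derivative frechet_derivative U (at x)) (at x)"
    using assms by (simp add: frechet_derivative_works)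
  then have "linear (frechet_derivative U (at x))"
    by (rule has_derivative_linear)
  \<comment> \<open>the gradient is the Riesz representative of the derivative\<close>
  then have "frechet_derivative U (at x) v
      = v \<bullet> adjoint (frechet_derivative U (at x)) 1" for v
    by (simp add: adjoint_works)
  with D have G: "GDERIV U x :> adjoint (frechet_derivative U (at x)) 1"
    unfolding gderiv_def by (metis (no_types, lifting) ext)
  have "GDERIV U x :> grad U x"
    unfolding grad_def
  proof (rule theI[where P = "\<lambda>D. GDERIV U x :> D", OF G])
    fix D assume "GDERIV U x :> D"
    with G have "v \<bullet> D = v \<bullet> adjoint (frechet_derivative U (at x)) 1" for v
      unfolding gderiv_def by (metis (no_types, lifting) has_derivative_unique)
    then show "D = adjoint (frechet_derivative U (at x)) 1"
      by (metis vector_eq_ldot)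
  qed
  then show ?thesis
    by (simp add: gderiv_def inner_commute)
qed

lemma frechet_derivative_eq_grad:
  assumes "U differentiable at x"
  shows "frechet_derivative U (at x) v = grad U x \<bullet> v"
  using has_derivative_grad[OF assms] by (simp add: frechet_derivative_at[symmetric])

lemma Ck_fun_2D:
  assumes "Ck_fun 2 U"
  shows "U differentiable at x"
    and "(\<lambda>x. grad U x \<bullet> v) differentiable at x"
    and "isCont (\<lambda>x. frechet_derivative (\<lambda>x. grad U x \<bullet> v) (at x) w) x"
proof -
  have U: "U differentiable at x" for x
    using assms by (simp add: numeral_2_eq_2 differentiable_on_def)
  then show "U differentiable at x" .
  show "(\<lambda>x. grad U x \<bullet> v) differentiable at x"
    "isCont (\<lambda>x. frechet_derivative (\<lambda>x. grad U x \<bullet> v) (at x) w) x"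
    using assms
    by (simp_all add: numeral_2_eq_2 differentiable_on_def frechet_derivative_eq_grad[OF U]
        continuous_on_eq_continuous_at)
qed

lemma grad_has_derivative_hessian:
  assumes "Ck_fun 2 U"
  shows "(grad U has_derivative (\<lambda>h. hessian U x *v h)) (at x)"
proof -
  have "grad U differentiable at x"
    using Ck_fun_2D(2)[OF assms] by (subst differentiable_componentwise_within) simp
  then show ?thesis
    by (simp add: hessian_def jacobian_works)
qed

theorem hessian_symmetric:
  assumes "Ck_fun 2 U"
  shows "(hessian U x *v u) \<bullet> v = u \<bullet> (hessian U x *v v)"
proof -
  have D: "((\<lambda>x. grad U x \<bullet> a) has_derivative (\<lambda>b. (hessian U x *v b) \<bullet> a)) (at x)" for a x
    by (intro has_derivative_inner_left grad_has_derivative_hessian[OF assms])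
  have C: "isCont (\<lambda>x. (hessian U x *v b) \<bullet> a) x" for a b
    using Ck_fun_2D(3)[OF assms, where v = a and w = b and x = x]
    by (simp add: frechet_derivative_at[OF D, symmetric])
  have "(hessian U x *v v) \<bullet> u = (hessian U x *v u) \<bullet> v"
    by (rule mixed_derivatives_commute[OF has_derivative_grad[OF Ck_fun_2D(1)[OF assms]] D D C C])
  then show ?thesis
    by (simp add: inner_commute)
qed

section \<open>Linearised dynamics in the unstable direction\<close>

lemma solves_autonomous_semiconj:
  assumes "solves_autonomous F T z" and "bounded_linear K"
    and "\<And>y. K (F y) = G (K y + c)"
  shows "solves_autonomous G T (\<lambda>t. K (z t) + c)"
  unfolding solves_autonomous_def
proof
  fix t assume "t \<in> T"
  then have "(z has_vector_derivative F (z t)) (at t within T)"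
    using assms(1) by (simp add: solves_autonomous_def)
  from bounded_linear.has_vector_derivative[OF assms(2) this]
  have "((\<lambda>t. K (z t) + c) has_vector_derivative K (F (z t)) + 0) (at t within T)"
    by (intro has_vector_derivative_add has_vector_derivative_const)
  then show "((\<lambda>t. K (z t) + c) has_vector_derivative G (K (z t) + c)) (at t within T)"
    by (simp add: assms(3))
qed

lemma langevin3_drift_has_derivative:
  assumes "Ck_fun 2 U"
  shows "(langevin3_drift L \<gamma> U has_derivative
           (\<lambda>(q, v, w). (v, - (1 / L) *\<^sub>R (hessian U \<theta> *v q) + \<gamma> *\<^sub>R w, - \<gamma> *\<^sub>R v - \<gamma> *\<^sub>R w)))
         (at (\<theta>, p, r))"
proof -
  have "((\<lambda>z. grad U (fst z)) has_derivative (\<lambda>h. hessian U \<theta> *v fst h)) (at (\<theta>, p, r))"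
    by (rule has_derivative_compose[of fst fst _ _ "grad U"])
      (auto intro!: derivative_eq_intros grad_has_derivative_hessian[OF assms])
  then show ?thesis
    unfolding langevin3_drift_def case_prod_beta
    by (auto intro!: derivative_eq_intros)
qed

lemma A_mat_mult:
  "A_mat L \<gamma> lam *v x
    = vector [x $ 2, lam / L * x $ 1 + \<gamma> * x $ 3, - \<gamma> * x $ 2 - \<gamma> * x $ 3]"
  by (simp add: vec_eq_iff forall_3 matrix_vector_mult_def sum_3 A_mat_def)

theorem unstable_coords_of_linearization:
  fixes U :: "real^'n \<Rightarrow> real" and \<sigma> e :: "real^'n"
  assumes C2: "Ck_fun 2 U"
    and unit: "norm e = 1" and eig: "hessian U \<sigma> *v e = (- lam) *\<^sub>R e"
  shows "(\<exists>z. solves_autonomous (linearization (langevin3_drift L \<gamma> U) (\<sigma>, 0, 0)) T z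
              \<and> X = (\<lambda>t. unstable_coords \<sigma> e (z t)))
         \<longleftrightarrow> solves_autonomous (\<lambda>x. A_mat L \<gamma> lam *v x) T X"
proof
  let ?F = "linearization (langevin3_drift L \<gamma> U) (\<sigma>, 0, 0)"
  have F: "?F (\<theta>, p, r)
      = (p, - (1 / L) *\<^sub>R (hessian U \<sigma> *v (\<theta> - \<sigma>)) + \<gamma> *\<^sub>R r, - \<gamma> *\<^sub>R p - \<gamma> *\<^sub>R r)" for \<theta> p r
    by (simp add: linearization_def
        frechet_derivative_at[OF langevin3_drift_has_derivative[OF C2], symmetric])
  { assume "\<exists>z. solves_autonomous ?F T z \<and> X = (\<lambda>t. unstable_coords \<sigma> e (z t))"
    then obtain z where z: "solves_autonomous ?F T z" and X: "X = (\<lambda>t. unstable_coords \<sigma> e (z t))"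
      by blast
    define K :: "(real^'n) \<times> (real^'n) \<times> (real^'n) \<Rightarrow> real^3"
      where "K = unstable_coords 0 e"
    have "linear K"
      by (rule linearI)
        (auto simp: K_def unstable_coords_def vec_eq_iff forall_3 inner_add_left)
    then have K: "bounded_linear K"
      by (simp add: linear_conv_bounded_linear)
    have coords: "unstable_coords \<sigma> e y = K y + - K (\<sigma>, 0, 0)" for y
      by (cases y) (simp add: K_def unstable_coords_def vec_eq_iff forall_3 inner_diff_left)
    have "K (?F y) = A_mat L \<gamma> lam *v (unstable_coords \<sigma> e y)" for y
    proof (cases y)
      case (fields \<theta> p r)
      \<comment> \<open>only here does the symmetry of the Hessian enter\<close>
      have "(hessian U \<sigma> *v (\<theta> - \<sigma>)) \<bullet> e = - lam * ((\<theta> - \<sigma>) \<bullet> e)"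
        by (simp add: hessian_symmetric[OF C2] eig)
      then show ?thesis
        by (simp add: fields F A_mat_mult K_def unstable_coords_def vec_eq_iff forall_3
            inner_add_left inner_diff_left)
    qed
    then show "solves_autonomous (\<lambda>x. A_mat L \<gamma> lam *v x) T X"
      unfolding X coords by (intro solves_autonomous_semiconj[OF z K])
  }
  assume X: "solves_autonomous (\<lambda>x. A_mat L \<gamma> lam *v x) T X"
  define J :: "real^3 \<Rightarrow> (real^'n) \<times> (real^'n) \<times> (real^'n)"
    where "J x = (x $ 1 *\<^sub>R e, x $ 2 *\<^sub>R e, x $ 3 *\<^sub>R e)" for x
  have "linear J"
    by (rule linearI) (auto simp: J_def scaleR_add_left)
  then have J: "bounded_linear J"
    by (simp add: linear_conv_bounded_linear)
  have "J (A_mat L \<gamma> lam *v x) = ?F (J x + (\<sigma>, 0, 0))" for x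
    by (simp add: J_def F A_mat_mult matrix_vector_mult_scaleR eig algebra_simps)
  then have "solves_autonomous ?F T (\<lambda>t. J (X t) + (\<sigma>, 0, 0))"
    by (intro solves_autonomous_semiconj[OF X J])
  moreover have "unstable_coords \<sigma> e (J x + (\<sigma>, 0, 0)) = x" for x
    using unit
    by (simp add: J_def unstable_coords_def vec_eq_iff forall_3 norm_eq_1)
  ultimately show "\<exists>z. solves_autonomous ?F T z \<and> X = (\<lambda>t. unstable_coords \<sigma> e (z t))"
    by (intro exI[of _ "\<lambda>t. J (X t) + (\<sigma>, 0, 0)"]) simp
qed

section \<open>The characteristic polynomial\<close>

lemma chi_poly_eq:
  "chi_poly L \<gamma> lam \<mu> = \<mu>^3 + \<gamma> * \<mu>^2 + (\<gamma>^2 - lam / L) * \<mu> - \<gamma> * lam / L"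
  by (simp add: chi_poly_def det_3 A_mat_def mat_def power2_eq_square power3_eq_cube
      algebra_simps add_divide_distrib)

text \<open>
  The coefficients change sign once, whatever the sign of \<open>c\<close>, so this is an instance of Descartes'
  rule of signs.
\<close>

lemma cubic_unique_positive_root:
  fixes b c d :: real
  assumes "b \<ge> 0" "d > 0"
  shows "\<exists>!x. x > 0 \<and> x^3 + b * x^2 + c * x - d = 0"
proof -
  let ?f = "\<lambda>x. x^3 + b * x^2 + c * x - d"
  \<comment> \<open>with this \<open>M\<close> one has \<open>M\<^sup>3 = M\<^sup>2 (1 + \<bar>c\<bar> + d) \<ge> \<bar>c\<bar> M + d\<close>\<close>
  define M where "M = 1 + \<bar>c\<bar> + d"
  have M: "M \<ge> 1" using assms by (simp add: M_def)
  have "0 \<le> (\<bar>c\<bar> + c) * M"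
    using M by (intro mult_nonneg_nonneg) linarith+
  moreover have "0 \<le> M * M" "0 \<le> \<bar>c\<bar> * (M * M - M)" "0 \<le> d * (M * M - 1)" "0 \<le> b * M^2"
    using M assms mult_mono[of 1 M 1 M] mult_right_mono[of 1 M M]
    by (auto intro!: mult_nonneg_nonneg)
  moreover have "M^3 = M * M + \<bar>c\<bar> * (M * M) + d * (M * M)"
    by (simp add: power3_eq_cube M_def algebra_simps)
  ultimately have "?f M \<ge> 0"
    unfolding ring_distribs by linarith
  moreover have "?f 0 \<le> 0" using assms by simp
  ultimately obtain x where x: "0 \<le> x" "?f x = 0"
    using IVT'[of ?f 0 0 M] M by (force intro!: continuous_intros)
  with assms have "x > 0"
    by (cases "x = 0") auto
  moreover have False if "0 < y" "y < z" "?f y = 0" "?f z = 0" for y z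
  proof -
    \<comment> \<open>eliminating \<open>c\<close> from the two equations leaves a positive quantity that would have to vanish\<close>
    have "y * ?f z - z * ?f y = (z - y) * (y * z * (y + z) + b * y * z + d)"
      by (simp add: power2_eq_square power3_eq_cube algebra_simps)
    moreover have "\<dots> > 0"
      using that assms by (intro mult_pos_pos add_nonneg_pos add_nonneg_nonneg) auto
    ultimately show False using that by simp
  qed
  ultimately show ?thesis
    using x(2) by (metis linorder_neqE)
qed

section \<open>The saddle\<close>

lemma index_one_saddle_lam_pos:
  assumes "index_one_saddle U \<sigma> lam"
  shows "lam > 0"
proof -
  have "- lam \<in># filter_mset (\<lambda>x. x < 0) (eigenvalues (hessian U \<sigma>))"
    using assms by (simp add: index_one_saddle_def)
  then show ?thesis
    by (simp del: filter_mset_eq_conv)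
qed

theorem lemma3p1:
  fixes U :: "real^'n \<Rightarrow> real" and \<sigma> e :: "real^'n" and lam L \<gamma> :: real
  assumes smooth: "smooth_fun U"
    and saddle: "index_one_saddle U \<sigma> lam"
    and unit_eigenvector: "norm e = 1" "hessian U \<sigma> *v e = (- lam) *\<^sub>R e"
    and L_pos: "L > 0" and \<gamma>_pos: "\<gamma> > 0"
  shows
    "langevin3_drift L \<gamma> U (\<sigma>, 0, 0) = 0
     \<and> langevin3_drift L \<gamma> U differentiable at (\<sigma>, 0, 0)
     \<and> (\<forall>T X. is_interval T \<longrightarrow>
          ((\<exists>z. solves_autonomous (linearization (langevin3_drift L \<gamma> U) (\<sigma>, 0, 0)) T z
                \<and> X = (\<lambda>t. unstable_coords \<sigma> e (z t)))
           \<longleftrightarrow> solves_autonomous (\<lambda>x. A_mat L \<gamma> lam *v x) T X))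
     \<and> (\<forall>\<mu>. chi_poly L \<gamma> lam \<mu>
            = \<mu>^3 + \<gamma> * \<mu>^2 + (\<gamma>^2 - lam / L) * \<mu> - \<gamma> * lam / L)
     \<and> (\<exists>!\<mu>. \<mu> > 0 \<and> chi_poly L \<gamma> lam \<mu> = 0)"
proof (intro conjI allI impI)
  have C2: "Ck_fun 2 U"
    using smooth by (simp add: smooth_fun_def)
  show "langevin3_drift L \<gamma> U (\<sigma>, 0, 0) = 0"
    using saddle by (simp add: langevin3_drift_def index_one_saddle_def zero_prod_def)
  show "langevin3_drift L \<gamma> U differentiable at (\<sigma>, 0, 0)"
    using langevin3_drift_has_derivative[OF C2] by (rule differentiableI)
  show "(\<exists>z. solves_autonomous (linearization (langevin3_drift L \<gamma> U) (\<sigma>, 0, 0)) T z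
             \<and> X = (\<lambda>t. unstable_coords \<sigma> e (z t)))
        \<longleftrightarrow> solves_autonomous (\<lambda>x. A_mat L \<gamma> lam *v x) T X" for T X
    by (rule unstable_coords_of_linearization[OF C2 unit_eigenvector])
  show "chi_poly L \<gamma> lam \<mu> = \<mu>^3 + \<gamma> * \<mu>^2 + (\<gamma>^2 - lam / L) * \<mu> - \<gamma> * lam / L" for \<mu>
    by (rule chi_poly_eq)
  have "\<gamma> * lam / L > 0"
    using \<gamma>_pos L_pos index_one_saddle_lam_pos[OF saddle] by simp
  then show "\<exists>!\<mu>. \<mu> > 0 \<and> chi_poly L \<gamma> lam \<mu> = 0"
    unfolding chi_poly_eq using \<gamma>_pos by (intro cubic_unique_positive_root) simp_all
qed

end
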